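(* For every integer $n\ge 6$, there exists a nonbipartite graph of order $n$ and size $\left\lfloor (n-1)^2/4\right\rfloor+2$ that contains exactly three weakly pancyclic vertices.
   Context: All graphs are finite and simple. The order of a graph is its number of vertices and its size is its number of edges. The girth $g(G)$ is the length of a shortest cycle of $G$, and the circumference $c(G)$ is the length of a longest cycle of $G$. A vertex $v$ of $G$ is called weakly pancyclic if for every integer $\ell$ with $g(G)\le \ell\le c(G)$, $v$ lies on a cycle of length $\ell$ in $G$. *)

theory Defs
  imports Main "HOL-Library.Extended_Nat"
begin

record 'a graph =
  verts :: "'a set"
  edges :: "'a set set"

definition simple_graph :: "'a graph \<Rightarrow> bool" where
  "simple_graph G \<longleftrightarrow>
     finite (verts G) \<and> (\<forall>e \<in> edges G. e \<subseteq> verts G \<and> card e = 2)"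

definition graph_order :: "'a graph \<Rightarrow> nat" where
  "graph_order G = card (verts G)"

definition graph_size :: "'a graph \<Rightarrow> nat" where
  "graph_size G = card (edges G)"

definition bipartite :: "'a graph \<Rightarrow> bool" where
  "bipartite G \<longleftrightarrow>
     (\<exists>A B. A \<union> B = verts G \<and> A \<inter> B = {} \<and>
        (\<forall>e \<in> edges G. \<exists>a \<in> A. \<exists>b \<in> B. e = {a, b}))"

text \<open>
  A cycle is given by the list of its vertices in cyclic order, the first vertex not being repeated
  at the end. Its length (number of edges) is therefore the length of the list.
\<close>

definition is_cycle :: "'a graph \<Rightarrow> 'a list \<Rightarrow> bool" where
  "is_cycle G c \<longleftrightarrow>
     3 \<le> length c \<and> distinct c \<and> set c \<subseteq> verts G \<and>
     (\<forall>i < length c. {c ! i, c ! (Suc i mod length c)} \<in> edges G)"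

text \<open>
  With extended naturals, an acyclic graph has girth \<open>\<infinity>\<close> and circumference \<open>0\<close>. In a simple graph
  (which is finite) with a cycle, the infimum and the supremum are a minimum and a maximum.
\<close>

definition girth :: "'a graph \<Rightarrow> enat" where
  "girth G = (INF c \<in> {c. is_cycle G c}. enat (length c))"

definition circumference :: "'a graph \<Rightarrow> enat" where
  "circumference G = (SUP c \<in> {c. is_cycle G c}. enat (length c))"

definition weakly_pancyclic_vertex :: "'a graph \<Rightarrow> 'a \<Rightarrow> bool" where
  "weakly_pancyclic_vertex G v \<longleftrightarrow>
     v \<in> verts G \<and>
     (\<forall>l::nat. girth G \<le> enat l \<and> enat l \<le> circumference G \<longrightarrow>
        (\<exists>c. is_cycle G c \<and> length c = l \<and> v \<in> set c))"

end

theory Submission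
  imports Defs
begin

text \<open>
  The even and the odd numbers below \<open>n\<close> form the classes of an (almost) balanced complete bipartite
  graph. Add the edge \<open>02\<close> and delete edges at \<open>0\<close> and \<open>2\<close> until \<open>1\<close> is the only common
  neighbour of these two vertices; then \<open>012\<close> is the only triangle, so only its vertices can be
  weakly pancyclic. The vertex \<open>0\<close> keeps just the odd neighbours \<open>1\<close> and \<open>5\<close>, which suffices for
  cycles of all lengths up to \<open>n\<close> through \<open>0\<close>, \<open>1\<close> and \<open>2\<close>, except that the length \<open>4\<close> needs two cycles.
\<close>

section \<open>Cycles as lists, triangles and bipartiteness\<close>

lemma is_cycleI_successively:
  assumes "3 \<le> length c" "distinct c" "set c \<subseteq> verts G"
    and "successively (\<lambda>u v. {u, v} \<in> edges G) c" "{last c, hd c} \<in> edges G"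
  shows "is_cycle G c"
proof -
  have "{c ! i, c ! (Suc i mod length c)} \<in> edges G" if "i < length c" for i
  \<comment> \<open>Only at the last index does \<open>Suc i mod length c\<close> wrap around to
    \<open>0\<close>; this index gives the closing edge.\<close>
  proof (cases "Suc i = length c")
    case True
    moreover have "c \<noteq> []" "i = length c - 1"
      using assms(1) True by auto
    ultimately have "c ! i = last c" "c ! (Suc i mod length c) = hd c"
      by (simp_all add: last_conv_nth hd_conv_nth)
    then show ?thesis using assms(5) by simp
  next
    case False
    then show ?thesis
      using assms(4) that by (simp add: successively_conv_nth)
  qed
  then show ?thesis
    using assms(1-3) unfolding is_cycle_def by blast
qed

lemma successively_upt:
  assumes "\<And>i. m \<le> i \<Longrightarrow> Suc i < n \<Longrightarrow> P i (Suc i)"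
  shows "successively P [m..<n]"
  using assms by (auto simp: successively_conv_nth)

lemma is_cycle_3E:
  assumes "is_cycle G c" "length c = 3" "v \<in> set c"
  obtains u w where "{v, u} \<in> edges G" "{u, w} \<in> edges G" "{v, w} \<in> edges G"
proof -
  obtain a b d where c: "c = [a, b, d]"
    using assms(2) by (auto simp: numeral_3_eq_3 length_Suc_conv)
  have "\<forall>i < 3. {c ! i, c ! (Suc i mod 3)} \<in> edges G"
    using assms(1,2) unfolding is_cycle_def by simp
  from this[rule_format, of 0] this[rule_format, of 1] this[rule_format, of 2]
  have "{a, b} \<in> edges G" "{b, d} \<in> edges G" "{d, a} \<in> edges G"
    by (simp_all add: c)
  \<comment> \<open>The reversed edges let each of \<open>a\<close>, \<open>b\<close>,
    \<open>d\<close> play the role of \<open>v\<close>.\<close>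
  moreover from this have "{a, d} \<in> edges G" "{b, a} \<in> edges G" "{d, b} \<in> edges G"
    by (simp_all add: insert_commute)
  moreover have "v = a \<or> v = b \<or> v = d"
    using assms(3) by (simp add: c)
  ultimately show thesis
    using that by blast
qed

lemma not_bipartite_triangle:
  assumes "{u, v} \<in> edges G" "{v, w} \<in> edges G" "{u, w} \<in> edges G"
  shows "\<not> bipartite G"
proof
  assume "bipartite G"
  then obtain A B where "A \<inter> B = {}"
    and *: "\<forall>e \<in> edges G. \<exists>a \<in> A. \<exists>b \<in> B. e = {a, b}"
    unfolding bipartite_def by blast
  \<comment> \<open>Two of the three vertices would share a class, but they are adjacent.\<close>
  moreover have "\<exists>a \<in> A. \<exists>b \<in> B. {u, v} = {a, b}" "\<exists>a \<in> A. \<exists>b \<in> B. {v, w} = {a, b}"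
    "\<exists>a \<in> A. \<exists>b \<in> B. {u, w} = {a, b}"
    using * assms by blast+
  ultimately show False
    by (auto simp: doubleton_eq_iff)
qed

section \<open>Girth, circumference and weak pancyclicity\<close>

lemma length_cycle_le:
  assumes "simple_graph G" "is_cycle G c"
  shows "length c \<le> graph_order G"
proof -
  have "length c = card (set c)"
    using assms(2) by (simp add: is_cycle_def distinct_card)
  also have "\<dots> \<le> card (verts G)"
    using assms by (intro card_mono) (auto simp: simple_graph_def is_cycle_def)
  finally show ?thesis
    by (simp add: graph_order_def)
qed

lemma girth_ge_3: "3 \<le> girth G"
  unfolding girth_def
  by (rule INF_greatest) (auto simp: is_cycle_def numeral_eq_enat)

lemma circumference_le_order:
  assumes "simple_graph G"
  shows "circumference G \<le> enat (graph_order G)"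
  unfolding circumference_def
  by (rule SUP_least) (use length_cycle_le[OF assms] in auto)

text \<open>The lengths from 3 to the order include all those from girth to circumference, so
  neither of these has to be computed.\<close>

lemma weakly_pancyclic_vertexI:
  assumes "simple_graph G" "v \<in> verts G"
    and "\<And>l. 3 \<le> l \<Longrightarrow> l \<le> graph_order G \<Longrightarrow> \<exists>c. is_cycle G c \<and> length c = l \<and> v \<in> set c"
  shows "weakly_pancyclic_vertex G v"
  unfolding weakly_pancyclic_vertex_def
proof (intro conjI allI impI)
  fix l assume "girth G \<le> enat l \<and> enat l \<le> circumference G"
  then have "3 \<le> enat l" "enat l \<le> enat (graph_order G)"
    using girth_ge_3[of G] circumference_le_order[OF assms(1)] by (blast intro: order_trans)+
  then show "\<exists>c. is_cycle G c \<and> length c = l \<and> v \<in> set c"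
    by (intro assms(3)) (auto simp: numeral_eq_enat)
qed (fact assms(2))

text \<open>Any triangle, even one avoiding \<open>v\<close>, puts 3 between girth and
  circumference.\<close>

lemma weakly_pancyclic_vertex_in_triangle:
  assumes "weakly_pancyclic_vertex G v" "is_cycle G c" "length c = 3"
  obtains d where "is_cycle G d" "length d = 3" "v \<in> set d"
proof -
  have "girth G \<le> enat 3" "enat 3 \<le> circumference G"
    unfolding girth_def circumference_def using assms(2,3)
    by (auto intro!: INF_lower2[of c] SUP_upper2[of c])
  then show thesis
    using assms(1) that unfolding weakly_pancyclic_vertex_def by blast
qed

section \<open>The graph and its size\<close>

definition split_arcs :: "nat \<Rightarrow> (nat \<times> nat) set" where
  "split_arcs n = insert (0, 2)
     {(i, j). i < n \<and> j < n \<and> even i \<and> odd j \<and> (i = 0 \<longrightarrow> j = 1 \<or> j = 5) \<and> (i = 2 \<longrightarrow> j \<noteq> 5)}"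

definition split_graph :: "nat \<Rightarrow> nat graph" where
  "split_graph n = \<lparr>verts = {..<n}, edges = (\<lambda>(i, j). {i, j}) ` split_arcs n\<rparr>"

lemma verts_split_graph [simp]: "verts (split_graph n) = {..<n}"
  by (simp add: split_graph_def)

lemma graph_order_split_graph [simp]: "graph_order (split_graph n) = n"
  by (simp add: graph_order_def)

text \<open>Each edge is stored as one ordered pair, its even end first (\<open>0\<close> before
  \<open>2\<close> in the edge between the two), so both orders must be tried.\<close>

lemma edge_split_graph_iff:
  "{i, j} \<in> edges (split_graph n) \<longleftrightarrow> (i, j) \<in> split_arcs n \<or> (j, i) \<in> split_arcs n"
  by (force simp: split_graph_def doubleton_eq_iff)

lemma simple_split_graph:
  assumes "n \<ge> 3"
  shows "simple_graph (split_graph n)"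
proof -
  have "i < n \<and> j < n \<and> i \<noteq> j" if "(i, j) \<in> split_arcs n" for i j
    using that assms by (auto simp: split_arcs_def)
  then show ?thesis
    by (fastforce simp: simple_graph_def split_graph_def)
qed

lemma card_even_below: "card {i. i < n \<and> even i} = (n + 1) div 2" for n :: nat
proof -
  have "{i. i < n \<and> even i} = (*) 2 ` {..<(n + 1) div 2}"
  proof (intro equalityI subsetI)
    fix i assume "i \<in> {i. i < n \<and> even i}"
    then show "i \<in> (*) 2 ` {..<(n + 1) div 2}"
      by (intro image_eqI[of _ _ "i div 2"]) auto
  qed auto
  then show ?thesis
    by (simp add: card_image inj_on_def)
qed

lemma card_odd_below: "card {i. i < n \<and> odd i} = n div 2" for n :: nat
proof -
  have "{i. i < n \<and> odd i} = (\<lambda>i. 2 * i + 1) ` {..<n div 2}"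
  proof (intro equalityI subsetI)
    fix i assume "i \<in> {i. i < n \<and> odd i}"
    then show "i \<in> (\<lambda>i. 2 * i + 1) ` {..<n div 2}"
      by (intro image_eqI[of _ _ "i div 2"]) (auto elim!: oddE)
  qed auto
  then show ?thesis
    by (simp add: card_image inj_on_def)
qed

text \<open>Ordered pairs are counted instead of edges: all of \<open>E \<times> O'\<close>, less
  the deleted ones, plus \<open>(0, 2)\<close>.\<close>

lemma graph_size_split_graph:
  assumes "n \<ge> 6"
  shows "graph_size (split_graph n) = (n - 1)\<^sup>2 div 4 + 2"
proof -
  define E O' where "E = {i. i < n \<and> even i}" and "O' = {i. i < n \<and> odd i}"
  \<comment> \<open>The deleted edges; as \<open>n \<ge> 6\<close>, both 1 and 5 lie in
    \<open>O'\<close>.\<close>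
  define R :: "(nat \<times> nat) set" where "R = {0} \<times> (O' - {1, 5}) \<union> {(2, 5)}"
  have fin: "finite E" "finite O'"
    by (auto simp: E_def O'_def)
  have arcs: "split_arcs n = insert (0, 2) (E \<times> O' - R)"
    by (auto simp: split_arcs_def E_def O'_def R_def)
  have "card (O' - {1, 5}) = n div 2 - 2"
    using assms fin by (subst card_Diff_subset) (auto simp: O'_def card_odd_below)
  then have "card R = n div 2 - 2 + 1"
    using fin unfolding R_def by (subst card_Un_disjoint) (auto simp: card_cartesian_product)
  moreover have "R \<subseteq> E \<times> O'"
    using assms by (auto simp: R_def E_def O'_def)
  moreover have "finite R"
    using fin by (simp add: R_def)
  ultimately have "card (E \<times> O' - R) = (n + 1) div 2 * (n div 2) - (n div 2 - 2 + 1)"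
    by (simp add: card_Diff_subset card_cartesian_product E_def O'_def card_even_below card_odd_below)
  moreover have "(0, 2) \<notin> E \<times> O' - R"
    by (simp add: O'_def)
  ultimately have "card (split_arcs n) = Suc ((n + 1) div 2 * (n div 2) - (n div 2 - 2 + 1))"
    using fin by (simp add: arcs)
  also have "\<dots> = (n - 1)\<^sup>2 div 4 + 2"
  proof (cases "even n")
    case True
    \<comment> \<open>With \<open>n div 2 = k + 3\<close> the truncated subtractions become
      exact.\<close>
    then obtain k where n: "n = 2 * (k + 3)"
      using assms by (auto elim!: evenE intro: that[of "n div 2 - 3"])
    \<comment> \<open>An odd square: the floor drops the remainder 1.\<close>
    have "(n - 1)\<^sup>2 = 4 * ((k + 2) * (k + 3)) + 1"
      by (simp add: n power2_eq_square algebra_simps)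
    then have "(n - 1)\<^sup>2 div 4 = (k + 2) * (k + 3)"
      by presburger
    then show ?thesis
      by (simp add: n algebra_simps)
  next
    case False
    then obtain k where n: "n = 2 * (k + 3) + 1"
      using assms by (auto elim!: oddE intro: that[of "n div 2 - 3"])
    have "(n - 1)\<^sup>2 div 4 = (k + 3) * (k + 3)"
      by (simp add: n power2_eq_square algebra_simps)
    then show ?thesis
      by (simp add: n algebra_simps)
  qed
  finally have "card (split_arcs n) = (n - 1)\<^sup>2 div 4 + 2" .
  \<comment> \<open>Parity recovers the order of a pair, and \<open>(0, 2)\<close> is the only pair
    of two even numbers.\<close>
  moreover have "inj_on (\<lambda>(i, j). {i, j}) (split_arcs n)"
    by (auto simp: inj_on_def split_arcs_def doubleton_eq_iff elim: oddE)
  ultimately show ?thesis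
    by (simp add: graph_size_def split_graph_def card_image)
qed

section \<open>Cycles of all lengths through 0, 1 and 2\<close>

lemma odd_cycle_split_graph:
  assumes "odd l" "3 \<le> l" "l \<le> n"
  shows "is_cycle (split_graph n) (1 # 0 # [2..<l])"
proof (rule is_cycleI_successively)
  have "successively (\<lambda>u v. {u, v} \<in> edges (split_graph n)) [2..<l]"
    using assms by (intro successively_upt) (auto simp: edge_split_graph_iff split_arcs_def)
  then show "successively (\<lambda>u v. {u, v} \<in> edges (split_graph n)) (1 # 0 # [2..<l])"
    using assms by (auto simp: successively_Cons edge_split_graph_iff split_arcs_def)
  \<comment> \<open>As \<open>l\<close> is odd, the last vertex \<open>l - 1\<close> is even and at
    least 2, hence adjacent to 1.\<close>
  show "{last (1 # 0 # [2..<l]), hd (1 # 0 # [2..<l])} \<in> edges (split_graph n)"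
    using assms by (auto simp: edge_split_graph_iff split_arcs_def)
qed (use assms in auto)

text \<open>An even cycle here does without the edge \<open>02\<close>: it leaves 0 through 5,
  climbs to the odd number \<open>l - 1\<close>, jumps to 4 and returns through 3 and 2 to
  1.\<close>

lemma even_cycle_split_graph:
  assumes "even l" "6 \<le> l" "l \<le> n"
  shows "is_cycle (split_graph n) (1 # 0 # [5..<l] @ [4, 3, 2])"
proof (rule is_cycleI_successively)
  have "successively (\<lambda>u v. {u, v} \<in> edges (split_graph n)) [5..<l]"
    using assms by (intro successively_upt) (auto simp: edge_split_graph_iff split_arcs_def)
  then show "successively (\<lambda>u v. {u, v} \<in> edges (split_graph n)) (1 # 0 # [5..<l] @ [4, 3, 2])"
    using assms
    by (auto simp: successively_Cons successively_append_iff edge_split_graph_iff split_arcs_def)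
  show "{last (1 # 0 # [5..<l] @ [4, 3, 2]), hd (1 # 0 # [5..<l] @ [4, 3, 2])}
      \<in> edges (split_graph n)"
    using assms by (auto simp: edge_split_graph_iff split_arcs_def)
qed (use assms in auto)

text \<open>No 4-cycle contains both 0 and 2: as opposite vertices they would need two common
  neighbours, and as consecutive ones they would need an edge between two odd numbers.\<close>

lemma four_cycles_split_graph:
  assumes "n \<ge> 6"
  shows "is_cycle (split_graph n) [2, 3, 4, 1]" "is_cycle (split_graph n) [0, 5, 4, 1]"
  using assms
  by (auto intro!: is_cycleI_successively simp: edge_split_graph_iff split_arcs_def)

lemma cycle_split_graph:
  assumes "n \<ge> 6" "v \<in> {0, 1, 2}" "3 \<le> l" "l \<le> n"
  shows "\<exists>c. is_cycle (split_graph n) c \<and> length c = l \<and> v \<in> set c"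
proof -
  consider "odd l" | "l = 4" | "even l" "6 \<le> l"
    using assms(3) by (cases "l \<in> {3, 4, 5}") auto
  then show ?thesis
  proof cases
    case 1
    then show ?thesis
      using odd_cycle_split_graph[of l n] assms
      by (intro exI[of _ "1 # 0 # [2..<l]"]) auto
  next
    case 2
    then show ?thesis
      using four_cycles_split_graph[OF assms(1)] assms(2)
      by (cases "v = 0") (force intro: exI[of _ "[0, 5, 4, 1]"] exI[of _ "[2, 3, 4, 1]"])+
  next
    case 3
    then show ?thesis
      using even_cycle_split_graph[of l n] assms
      by (intro exI[of _ "1 # 0 # [5..<l] @ [4, 3, 2]"]) auto
  qed
qed

section \<open>Triangles and the weakly pancyclic vertices\<close>

lemma triangle_split_graph:
  assumes "{u, v} \<in> edges (split_graph n)" "{v, w} \<in> edges (split_graph n)"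
    "{u, w} \<in> edges (split_graph n)"
  shows "u \<in> {0, 1, 2}"
  \<comment> \<open>Two vertices of a triangle have equal parity, so they are 0 and 2; of the odd
    neighbours 1 and 5 of 0, only 1 is adjacent to 2.\<close>
  using assms by (auto simp: edge_split_graph_iff split_arcs_def)

lemma weakly_pancyclic_vertices_split_graph:
  assumes "n \<ge> 6"
  shows "{v. weakly_pancyclic_vertex (split_graph n) v} = {0, 1, 2}"
proof (intro equalityI subsetI)
  fix v :: nat
  assume v: "v \<in> {0, 1, 2}"
  have "weakly_pancyclic_vertex (split_graph n) v"
  proof (rule weakly_pancyclic_vertexI)
    show "simple_graph (split_graph n)"
      using assms by (intro simple_split_graph) simp
    show "v \<in> verts (split_graph n)"
      using v assms by auto
  qed (use cycle_split_graph[OF assms v] in simp)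
  then show "v \<in> {v. weakly_pancyclic_vertex (split_graph n) v}"
    by simp
next
  fix v
  assume "v \<in> {v. weakly_pancyclic_vertex (split_graph n) v}"
  then have "weakly_pancyclic_vertex (split_graph n) v"
    by simp
  \<comment> \<open>A triangle through 0 makes 3 one of the required lengths, so \<open>v\<close>
    lies on a triangle too.\<close>
  moreover obtain c where "is_cycle (split_graph n) c" "length c = 3"
    using cycle_split_graph[of n 0 3] assms by auto
  ultimately obtain d where "is_cycle (split_graph n) d" "length d = 3" "v \<in> set d"
    by (rule weakly_pancyclic_vertex_in_triangle)
  then show "v \<in> {0, 1, 2}"
    by (metis is_cycle_3E triangle_split_graph)
qed

theorem theorem4:
  fixes n :: nat
  assumes "n \<ge> 6"
  shows "\<exists>G :: nat graph. simple_graph G \<and> \<not> bipartite G \<and>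
           graph_order G = n \<and> graph_size G = (n - 1)\<^sup>2 div 4 + 2 \<and>
           card {v. weakly_pancyclic_vertex G v} = 3"
proof (intro exI[of _ "split_graph n"] conjI)
  show "simple_graph (split_graph n)"
    using assms by (intro simple_split_graph) simp
  show "\<not> bipartite (split_graph n)"
    using assms
    by (intro not_bipartite_triangle[of 0 1 _ 2]) (auto simp: edge_split_graph_iff split_arcs_def)
  show "graph_size (split_graph n) = (n - 1)\<^sup>2 div 4 + 2"
    by (rule graph_size_split_graph[OF assms])
  show "card {v. weakly_pancyclic_vertex (split_graph n) v} = 3"
    by (simp add: weakly_pancyclic_vertices_split_graph[OF assms])
qed simp

end
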